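(* The set $\mathcal{M}$ of universal distance matrices is nonempty and, moreover, is an everywhere dense $G_\delta$-subset of the cone $\mathcal{R}$ of infinite distance matrices, in the weak topology of $\mathcal{R}$.
   Context: $\mathcal{R}$ is the set of infinite real matrices $r=\{r_{i,j}\}_{i,j=1}^\infty$ with $r_{i,i}=0$, $r_{i,j}\ge 0$, $r_{i,j}=r_{j,i}$ and $r_{i,k}+r_{k,j}\ge r_{i,j}$ for all $i,j,k$ (infinite distance matrices). It is a convex cone in $\mathbb{R}^{\mathbb{N}^2}$ and carries the weak topology, i.e. the topology induced from the product topology (entrywise convergence). A distance matrix is called true if all its off-diagonal entries are nonzero. For $n\ge1$, $p_n(r)=\{r_{i,j}\}_{i,j=1}^n$ denotes the upper-left (NW) corner of order $n$. For a distance matrix $q=\{q_{i,j}\}_{i,j=1}^n$ of order $n$ (same conditions, finite index set), the set of admissible vectors is $$A(q)=\{a=(a_1,\dots,a_n)\in\mathbb{R}^n : |a_i-a_j|\le q_{i,j}\le a_i+a_j,\ i,j=1,\dots,n\}.$$ An infinite true distance matrix $r\in\mathcal{R}$ is called universal if for each $\epsilon>0$, each $n\in\mathbb{N}$ and each $a=(a_1,\dots,a_n)\in A(p_n(r))$ there exists $m\in\mathbb{N}$ such that $\max_{i=1,\dots,n}|r_{i,m}-a_i|<\epsilon$. $\mathcal{M}\subset\mathcal{R}$ denotes the set of universal matrices. *)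

theory Defs
  imports "HOL-Analysis.Analysis"
begin

text \<open>
  Indices start at 0: infinite matrices are functions on \<open>nat \<times> nat\<close>, and matrices (vectors) of
  order \<open>n\<close> are functions on \<open>{..<n} \<times> {..<n}\<close> (on \<open>{..<n}\<close>), with value \<open>undefined\<close> elsewhere.
\<close>

definition infinite_distance_matrices :: "(nat \<times> nat \<Rightarrow> real) set" where
  "infinite_distance_matrices =
     {r. (\<forall>i. r (i, i) = 0) \<and> (\<forall>i j. r (i, j) \<ge> 0) \<and> (\<forall>i j. r (i, j) = r (j, i)) \<and>
         (\<forall>i j k. r (i, k) + r (k, j) \<ge> r (i, j))}"

definition weak_topology :: "(nat \<times> nat \<Rightarrow> real) topology" where
  "weak_topology =
     subtopology (product_topology (\<lambda>_. euclideanreal) UNIV) infinite_distance_matrices"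

definition true_matrix :: "(nat \<times> nat \<Rightarrow> real) \<Rightarrow> bool" where
  "true_matrix r \<longleftrightarrow> (\<forall>i j. i \<noteq> j \<longrightarrow> r (i, j) \<noteq> 0)"

definition nw_corner :: "nat \<Rightarrow> (nat \<times> nat \<Rightarrow> real) \<Rightarrow> nat \<times> nat \<Rightarrow> real" where
  "nw_corner n r = restrict r ({..<n} \<times> {..<n})"

definition admissible_vectors :: "nat \<Rightarrow> (nat \<times> nat \<Rightarrow> real) \<Rightarrow> (nat \<Rightarrow> real) set" where
  "admissible_vectors n q =
     {a \<in> {..<n} \<rightarrow>\<^sub>E UNIV. \<forall>i<n. \<forall>j<n. \<bar>a i - a j\<bar> \<le> q (i, j) \<and> q (i, j) \<le> a i + a j}"

definition universal_matrices :: "(nat \<times> nat \<Rightarrow> real) set" where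
  "universal_matrices =
     {r \<in> infinite_distance_matrices. true_matrix r \<and>
        (\<forall>\<epsilon>>0. \<forall>n\<ge>1. \<forall>a \<in> admissible_vectors n (nw_corner n r).
           \<exists>m. Max ((\<lambda>i. \<bar>r (i, m) - a i\<bar>) ` {..<n}) < \<epsilon>)}"

end

theory Submission
  imports Defs
begin

text \<open>
  The set of universal matrices is written as a countable intersection of open dense subsets of the
  cone, and Baire's theorem is applied; the cone is completely metrizable, being closed in
  the space of real functions on the countable set \<open>nat \<times> nat\<close>.

  The obvious conditions ``every admissible vector of \<open>r\<close> is approximated by a column of \<open>r\<close>'' range
  over uncountably many vectors, and admissibility itself depends on \<open>r\<close>. Both problems disappear
  when admissibility is relaxed by a slack \<open>\<delta>\<close>: for a fixed vector \<open>c\<close>, the condition ``if \<open>c\<close> is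
  admissible up to \<open>\<delta>\<close>, then some column is closer than \<open>\<delta>\<close> to \<open>c\<close>'' is open in \<open>r\<close>, because its
  premise is closed and its conclusion is open. Rational \<open>c\<close> and \<open>\<delta> = 1 / k\<close> suffice to recover
  universality, because a rational vector near an admissible one is admissible up to \<open>\<delta>\<close>
  (\<open>universal_matrices_eq_Inter\<close>).

  What makes the slack harmless is a Katetov-type extension (\<open>slack_admissible_extension\<close>): a vector
  admissible up to \<open>\<delta>\<close> lies within \<open>\<delta> / 2\<close> of an exactly admissible one, which moreover is the
  restriction of a vector admissible for the whole infinite matrix. This gives that universal
  matrices satisfy the relaxed conditions, and also that each relaxed condition is dense
  (\<open>realizing_dense\<close>): the extended vector may be installed as the \<open>k\<close>-th row and column of the
  matrix, and for \<open>k \<rightarrow> \<infinity>\<close> these modifications converge entrywise to the original matrix.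
\<close>

section \<open>The cone of distance matrices as a closed subspace\<close>

lemma infinite_distance_matricesD:
  assumes "r \<in> infinite_distance_matrices"
  shows "r (i, i) = 0" "r (i, j) \<ge> 0" "r (i, j) = r (j, i)" "r (i, j) \<le> r (i, k) + r (k, j)"
  using assms by (auto simp: infinite_distance_matrices_def)

lemma closed_infinite_distance_matrices: "closed infinite_distance_matrices"
  unfolding infinite_distance_matrices_def
  by (intro closed_Collect_conj closed_Collect_all closed_Collect_eq closed_Collect_le
        continuous_intros continuous_on_product_coordinates)

lemma weak_topology_eq: "weak_topology = top_of_set infinite_distance_matrices"
  by (simp add: weak_topology_def euclidean_product_topology)

lemma topspace_weak_topology [simp]: "topspace weak_topology = infinite_distance_matrices"
  by (simp add: weak_topology_eq)

lemma completely_metrizable_weak_topology: "completely_metrizable_space weak_topology"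
  unfolding weak_topology_eq
  by (intro completely_metrizable_space_closedin completely_metrizable_space_euclidean)
     (simp add: closed_infinite_distance_matrices)

lemma openin_weak_topology:
  assumes "open U"
  shows "openin weak_topology (infinite_distance_matrices \<inter> U)"
  using assms by (auto simp: weak_topology_eq)

lemma weak_topology_dense_by_sequences:
  assumes "S \<subseteq> infinite_distance_matrices"
    and "\<And>r. r \<in> infinite_distance_matrices \<Longrightarrow>
           \<exists>s. (\<forall>k. s k \<in> S) \<and> (\<forall>i j. (\<lambda>k. s k (i, j)) \<longlonglongrightarrow> r (i, j))"
  shows "weak_topology closure_of S = topspace weak_topology"
proof -
  have "r \<in> closure S" if r: "r \<in> infinite_distance_matrices" for r
  proof -
    obtain s where s: "\<And>k. s k \<in> S" "\<And>i j. (\<lambda>k. s k (i, j)) \<longlonglongrightarrow> r (i, j)"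
      using assms(2)[OF r] by blast
    have "limitin (product_topology (\<lambda>_. euclideanreal) UNIV) s r sequentially"
      using s(2) by (auto simp: limitin_componentwise)
    then have "s \<longlonglongrightarrow> r"
      by (simp add: euclidean_product_topology)
    then show ?thesis
      using s(1) by (auto simp: closure_sequential)
  qed
  then show ?thesis
    using assms(1) by (auto simp: weak_topology_eq closure_of_subtopology Int_absorb1)
qed

section \<open>Nonvanishing of off-diagonal entries\<close>

definition nonvanishing_at :: "nat \<Rightarrow> nat \<Rightarrow> (nat \<times> nat \<Rightarrow> real) set" where
  "nonvanishing_at i j = infinite_distance_matrices \<inter> {r. r (i, j) \<noteq> 0}"

lemma nonvanishing_at_open: "openin weak_topology (nonvanishing_at i j)"
  unfolding nonvanishing_at_def
  by (intro openin_weak_topology open_Collect_neq continuous_intros continuous_on_product_coordinates)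

text \<open>Adding a small multiple of the discrete metric stays in the cone and separates all points.\<close>

lemma nonvanishing_at_dense:
  assumes "i \<noteq> j"
  shows "weak_topology closure_of nonvanishing_at i j = topspace weak_topology"
proof (rule weak_topology_dense_by_sequences)
  show "nonvanishing_at i j \<subseteq> infinite_distance_matrices"
    by (auto simp: nonvanishing_at_def)
next
  fix r assume r: "r \<in> infinite_distance_matrices"
  note rD = infinite_distance_matricesD[OF r]
  define s where "s = (\<lambda>k (a, b). r (a, b) + (if a = b then 0 else inverse (real (Suc k))))"
  have "s k \<in> nonvanishing_at i j" for k
  proof -
    define e where "e = inverse (real (Suc k))"
    have "e > 0" by (simp add: e_def)
    have s: "s k (a, b) = r (a, b) + (if a = b then 0 else e)" for a b
      by (simp add: s_def e_def)
    have "s k (a, b) \<le> s k (a, c) + s k (c, b)" for a b c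
      using rD(4)[of a b c] \<open>e > 0\<close> by (auto simp: s)
    moreover have "s k (i, j) \<noteq> 0"
      using rD(2)[of i j] \<open>e > 0\<close> assms by (simp add: s)
    ultimately show ?thesis
      using rD(1,2) rD(3) unfolding nonvanishing_at_def infinite_distance_matrices_def
      by (auto simp: s_def)
  qed
  moreover have "(\<lambda>k. s k (a, b)) \<longlonglongrightarrow> r (a, b)" for a b
  proof -
    have "(\<lambda>k. r (a, b) + inverse (real (Suc k))) \<longlonglongrightarrow> r (a, b) + 0"
      by (intro tendsto_intros LIMSEQ_inverse_real_of_nat)
    then show ?thesis by (cases "a = b") (simp_all add: s_def del: of_nat_Suc)
  qed
  ultimately show "\<exists>s. (\<forall>k. s k \<in> nonvanishing_at i j) \<and>
                       (\<forall>i j. (\<lambda>k. s k (i, j)) \<longlonglongrightarrow> r (i, j))"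
    by blast
qed

section \<open>Admissibility with slack\<close>

definition slack_admissible :: "real \<Rightarrow> nat \<Rightarrow> (nat \<times> nat \<Rightarrow> real) \<Rightarrow> (nat \<Rightarrow> real) \<Rightarrow> bool" where
  "slack_admissible \<delta> n r c \<longleftrightarrow>
     (\<forall>i<n. \<forall>j<n. \<bar>c i - c j\<bar> \<le> r (i, j) + \<delta> \<and> r (i, j) \<le> c i + c j + \<delta>)"

text \<open>
  The largest function \<open>f\<close> that is 1-Lipschitz for \<open>r\<close> and bounded by \<open>c\<close> on the first \<open>n\<close> points is
  \<open>i \<mapsto> min (c j + r (i, j))\<close>. The slack in the Lipschitz bounds costs it at most \<open>\<delta>\<close> against \<open>c\<close>,
  and adding \<open>\<delta> / 2\<close> both centres this error and repairs the slack in the bounds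
  \<open>r (i, j) \<le> c i + c j + \<delta>\<close>.
\<close>

lemma slack_admissible_extension:
  assumes r: "r \<in> infinite_distance_matrices" and n: "n > 0" and c: "slack_admissible \<delta> n r c"
  obtains f where "\<And>i j. \<bar>f i - f j\<bar> \<le> r (i, j)" "\<And>i j. r (i, j) \<le> f i + f j"
    "\<And>i. i < n \<Longrightarrow> \<bar>f i - c i\<bar> \<le> \<delta> / 2"
proof
  note rD = infinite_distance_matricesD[OF r]
  define f where "f = (\<lambda>i. Min ((\<lambda>j. c j + r (i, j)) ` {..<n}) + \<delta> / 2)"
  have upper: "f i \<le> c j + r (i, j) + \<delta> / 2" if "j < n" for i j
    using that by (auto simp: f_def)
  have attained: "\<exists>j<n. f i = c j + r (i, j) + \<delta> / 2" for i
  proof -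
    have "Min ((\<lambda>j. c j + r (i, j)) ` {..<n}) \<in> (\<lambda>j. c j + r (i, j)) ` {..<n}"
      using n by (intro Min_in) auto
    then show ?thesis by (auto simp: f_def)
  qed
  have cD: "c i - c j \<le> r (i, j) + \<delta>" "r (i, j) \<le> c i + c j + \<delta>" if "i < n" "j < n" for i j
    using c that unfolding slack_admissible_def by (fastforce dest: abs_le_D1)+
  have lipschitz: "f i - f j \<le> r (i, j)" for i j
  proof -
    obtain k where "k < n" "f j = c k + r (j, k) + \<delta> / 2"
      using attained by blast
    then show ?thesis
      using upper[of k i] rD(4)[of i k j] by linarith
  qed
  show "\<bar>f i - f j\<bar> \<le> r (i, j)" for i j
    using lipschitz[of i j] lipschitz[of j i] rD(3)[of i j] by linarith
  show "r (i, j) \<le> f i + f j" for i j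
  proof -
    obtain k l where kl: "k < n" "f i = c k + r (i, k) + \<delta> / 2" "l < n" "f j = c l + r (j, l) + \<delta> / 2"
      using attained by metis
    then show ?thesis
      using cD(2)[of k l] rD(4)[of i j k] rD(4)[of k j l] rD(3)[of l j] by linarith
  qed
  show "\<bar>f i - c i\<bar> \<le> \<delta> / 2" if "i < n" for i
  proof -
    obtain k where "k < n" "f i = c k + r (i, k) + \<delta> / 2"
      using attained by blast
    then show ?thesis
      using cD(1)[of i k] upper[of i i] rD(1)[of i] that by linarith
  qed
qed

section \<open>Matrices realizing a vector\<close>

definition realizing :: "real \<Rightarrow> nat \<Rightarrow> (nat \<Rightarrow> real) \<Rightarrow> (nat \<times> nat \<Rightarrow> real) set" where
  "realizing \<delta> n c =
     {r \<in> infinite_distance_matrices.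
        slack_admissible \<delta> n r c \<longrightarrow> (\<exists>m. \<forall>i<n. \<bar>r (i, m) - c i\<bar> < \<delta>)}"

lemma realizing_open: "openin weak_topology (realizing \<delta> n c)"
proof -
  have "closed {r. slack_admissible \<delta> n r c}"
    unfolding slack_admissible_def
    by (intro closed_Collect_all closed_Collect_imp closed_Collect_conj closed_Collect_le
          open_Collect_const continuous_intros continuous_on_product_coordinates)
  then have 1: "open (- {r. slack_admissible \<delta> n r c})"
    by (simp add: open_Compl)
  have "open (\<Inter>i\<in>{..<n}. {r. \<bar>r (i, m) - c i\<bar> < \<delta>})" for m :: nat
    by (intro open_INT ballI finite_lessThan open_Collect_less continuous_intros
          continuous_on_product_coordinates)
  then have 2: "open (\<Union>m::nat. \<Inter>i\<in>{..<n}. {r. \<bar>r (i, m) - c i\<bar> < \<delta>})"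
    by blast
  have "realizing \<delta> n c = infinite_distance_matrices \<inter>
      (- {r. slack_admissible \<delta> n r c} \<union> (\<Union>m. \<Inter>i\<in>{..<n}. {r. \<bar>r (i, m) - c i\<bar> < \<delta>}))"
    by (auto simp: realizing_def)
  then show ?thesis
    using openin_weak_topology[OF open_Un[OF 1 2]] by simp
qed

definition replace_point :: "nat \<Rightarrow> (nat \<Rightarrow> real) \<Rightarrow> (nat \<times> nat \<Rightarrow> real) \<Rightarrow> nat \<times> nat \<Rightarrow> real" where
  "replace_point k f r =
     (\<lambda>(i, j). if i = j then 0 else if i = k then f j else if j = k then f i else r (i, j))"

lemma replace_point_in_cone:
  assumes r: "r \<in> infinite_distance_matrices"
    and f: "\<And>i j. \<bar>f i - f j\<bar> \<le> r (i, j)" "\<And>i j. r (i, j) \<le> f i + f j"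
  shows "replace_point k f r \<in> infinite_distance_matrices"
proof -
  note rD = infinite_distance_matricesD[OF r]
  have nonneg: "f i \<ge> 0" for i
    using f(2)[of i i] rD(1)[of i] by linarith
  have lipschitz: "f i \<le> r (i, j) + f j" "f i \<le> r (j, i) + f j" for i j
    using f(1)[of i j] rD(3)[of i j] by linarith+
  have "replace_point k f r (a, b) \<le> replace_point k f r (a, c) + replace_point k f r (c, b)" for a b c
    using rD(4)[of a b c] rD(2)[of a b] nonneg lipschitz f(2)[of a b]
    by (auto simp: replace_point_def add.commute)
  then show ?thesis
    using rD nonneg unfolding infinite_distance_matrices_def
    by (auto simp: replace_point_def)
qed

text \<open>
  A matrix for which \<open>c\<close> is not admissible up to the slack satisfies the condition vacuously.
  Otherwise \<open>c\<close>, suitably extended, is installed as a new point with a large index, so that every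
  fixed entry is eventually unchanged. The index has to be at least \<open>n\<close>, since the first \<open>n\<close> points
  must be kept.
\<close>

lemma realizing_dense:
  assumes "\<delta> > 0"
  shows "weak_topology closure_of realizing \<delta> n c = topspace weak_topology"
proof (rule weak_topology_dense_by_sequences)
  show "realizing \<delta> n c \<subseteq> infinite_distance_matrices"
    by (auto simp: realizing_def)
next
  fix r assume r: "r \<in> infinite_distance_matrices"
  show "\<exists>s. (\<forall>k. s k \<in> realizing \<delta> n c) \<and> (\<forall>i j. (\<lambda>k. s k (i, j)) \<longlonglongrightarrow> r (i, j))"
  proof (cases "n > 0 \<and> slack_admissible \<delta> n r c")
    case False
    then have "r \<in> realizing \<delta> n c"
      using r by (auto simp: realizing_def)
    then show ?thesis
      by (intro exI[of _ "\<lambda>_. r"]) auto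
  next
    case True
    then obtain f where f: "\<And>i j. \<bar>f i - f j\<bar> \<le> r (i, j)" "\<And>i j. r (i, j) \<le> f i + f j"
        "\<And>i. i < n \<Longrightarrow> \<bar>f i - c i\<bar> \<le> \<delta> / 2"
      using slack_admissible_extension[OF r] by metis
    define s where "s = (\<lambda>k. replace_point (n + k) f r)"
    have "s k \<in> realizing \<delta> n c" for k
    proof -
      have "\<bar>s k (i, n + k) - c i\<bar> < \<delta>" if "i < n" for i
        using f(3)[OF that] that assms by (auto simp: s_def replace_point_def)
      moreover have "s k \<in> infinite_distance_matrices"
        unfolding s_def using replace_point_in_cone[OF r f(1,2)] .
      ultimately show ?thesis
        by (auto simp: realizing_def)
    qed
    moreover have "(\<lambda>k. s k (i, j)) \<longlonglongrightarrow> r (i, j)" for i j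
    proof (rule tendsto_eventually)
      show "\<forall>\<^sub>F k in sequentially. s k (i, j) = r (i, j)"
        using eventually_gt_at_top[of "max i j"]
        by eventually_elim
           (auto simp: s_def replace_point_def infinite_distance_matricesD(1)[OF r])
    qed
    ultimately show ?thesis by blast
  qed
qed

section \<open>Universality as a countable intersection\<close>

text \<open>
  Slack zero is exact admissibility, and this depends only on the corner of order \<open>n\<close> and on the
  first \<open>n\<close> coordinates; hence corners and restricted vectors can be traded for the full functions.
\<close>

lemma universal_matrix_iff:
  "r \<in> universal_matrices \<longleftrightarrow>
     r \<in> infinite_distance_matrices \<and> true_matrix r \<and>
     (\<forall>\<epsilon>>0. \<forall>n\<ge>1. \<forall>a. slack_admissible 0 n r a \<longrightarrow> (\<exists>m. \<forall>i<n. \<bar>r (i, m) - a i\<bar> < \<epsilon>))"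
    (is "_ \<longleftrightarrow> _ \<and> _ \<and> (\<forall>\<epsilon>>0. \<forall>n\<ge>1. ?Q \<epsilon> n)")
proof -
  have "(\<forall>a \<in> admissible_vectors n (nw_corner n r).
           \<exists>m. Max ((\<lambda>i. \<bar>r (i, m) - a i\<bar>) ` {..<n}) < \<epsilon>) \<longleftrightarrow> ?Q \<epsilon> n" (is "?P \<longleftrightarrow> _")
    if "n \<ge> 1" for n and \<epsilon> :: real
  proof -
    have Max_iff: "Max ((\<lambda>i. \<bar>r (i, m) - a i\<bar>) ` {..<n}) < \<epsilon> \<longleftrightarrow> (\<forall>i<n. \<bar>r (i, m) - a i\<bar> < \<epsilon>)"
      for m and a :: "nat \<Rightarrow> real"
      using that by (subst Max_less_iff) (auto simp: lessThan_empty_iff)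
    have adm_iff: "a \<in> admissible_vectors n (nw_corner n r) \<longleftrightarrow>
        a \<in> {..<n} \<rightarrow>\<^sub>E UNIV \<and> slack_admissible 0 n r a" for a
      by (auto simp: admissible_vectors_def nw_corner_def slack_admissible_def)
    show ?thesis
    proof
      assume P: ?P
      show "?Q \<epsilon> n"
      proof (intro allI impI)
        fix a assume "slack_admissible 0 n r a"
        then have "restrict a {..<n} \<in> admissible_vectors n (nw_corner n r)"
          by (auto simp: adm_iff slack_admissible_def)
        then show "\<exists>m. \<forall>i<n. \<bar>r (i, m) - a i\<bar> < \<epsilon>"
          using P by (fastforce simp: Max_iff)
      qed
    next
      assume "?Q \<epsilon> n"
      then show ?P
        by (auto simp: adm_iff Max_iff)
    qed
  qed
  then show ?thesis
    by (auto simp: universal_matrices_def)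
qed

lemma universal_imp_realizing:
  assumes r: "r \<in> universal_matrices" and "\<delta> > 0"
  shows "r \<in> realizing \<delta> n c"
proof -
  have rR: "r \<in> infinite_distance_matrices"
    using r by (simp add: universal_matrix_iff)
  have "\<exists>m. \<forall>i<n. \<bar>r (i, m) - c i\<bar> < \<delta>" if c: "slack_admissible \<delta> n r c" and n: "n > 0"
  proof -
    obtain f where f: "\<And>i j. \<bar>f i - f j\<bar> \<le> r (i, j)" "\<And>i j. r (i, j) \<le> f i + f j"
        "\<And>i. i < n \<Longrightarrow> \<bar>f i - c i\<bar> \<le> \<delta> / 2"
      using slack_admissible_extension[OF rR n c] by metis
    have "slack_admissible 0 n r f"
      using f by (auto simp: slack_admissible_def)
    moreover have "\<delta> / 2 > 0" "n \<ge> 1"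
      using \<open>\<delta> > 0\<close> n by auto
    ultimately obtain m where m: "\<And>i. i < n \<Longrightarrow> \<bar>r (i, m) - f i\<bar> < \<delta> / 2"
      using r unfolding universal_matrix_iff by blast
    have "\<bar>r (i, m) - c i\<bar> < \<delta>" if "i < n" for i
      using m[OF that] f(3)[OF that] by linarith
    then show ?thesis by blast
  qed
  then show ?thesis
    using rR by (cases "n > 0") (auto simp: realizing_def)
qed

text \<open>Moving each coordinate of an admissible vector by at most \<open>\<delta> / 2\<close> creates slack at most \<open>\<delta>\<close>.\<close>

lemma universal_if_realizing_rationals:
  assumes r: "r \<in> infinite_distance_matrices" and "true_matrix r"
    and realizing: "\<And>l k. r \<in> realizing (inverse (real (Suc k))) (length l) (\<lambda>i. of_rat (l ! i))"
  shows "r \<in> universal_matrices"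
  unfolding universal_matrix_iff
proof (intro conjI allI impI assms(1,2))
  fix \<epsilon> :: real and n :: nat and a :: "nat \<Rightarrow> real"
  assume "\<epsilon> > 0" and a: "slack_admissible 0 n r a"
  \<comment> \<open>The final error is \<open>\<delta>\<close> from the realizing column plus \<open>\<delta> / 2\<close> from rounding \<open>a\<close>.\<close>
  then obtain k where k: "inverse (real (Suc k)) < \<epsilon> / 2"
    using reals_Archimedean[of "\<epsilon> / 2"] by auto
  define \<delta> where "\<delta> = inverse (real (Suc k))"
  have "\<delta> > 0" by (simp add: \<delta>_def)
  have "\<exists>q. \<bar>of_rat q - a i\<bar> < \<delta> / 2" for i
  proof -
    obtain q where "a i - \<delta> / 2 < of_rat q" "of_rat q < a i + \<delta> / 2"
      using of_rat_dense[of "a i - \<delta> / 2" "a i + \<delta> / 2"] \<open>\<delta> > 0\<close> by auto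
    then have "\<bar>of_rat q - a i\<bar> < \<delta> / 2" by linarith
    then show ?thesis by blast
  qed
  then obtain q where q: "\<And>i. \<bar>of_rat (q i) - a i\<bar> < \<delta> / 2"
    by metis
  define l where "l = map q [0..<n]"
  have l: "length l = n" "\<And>i. i < n \<Longrightarrow> \<bar>of_rat (l ! i) - a i\<bar> < \<delta> / 2"
    using q by (simp_all add: l_def)
  have "slack_admissible \<delta> n r (\<lambda>i. of_rat (l ! i))"
    unfolding slack_admissible_def
  proof (intro allI impI)
    fix i j assume ij: "i < n" "j < n"
    have "\<bar>a i - a j\<bar> \<le> r (i, j)" "r (i, j) \<le> a i + a j"
      using a ij by (auto simp: slack_admissible_def)
    then show "\<bar>of_rat (l ! i) - of_rat (l ! j)\<bar> \<le> r (i, j) + \<delta> \<and>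
               r (i, j) \<le> of_rat (l ! i) + of_rat (l ! j) + \<delta>"
      using l(2)[OF ij(1)] l(2)[OF ij(2)] by linarith
  qed
  then obtain m where m: "\<And>i. i < n \<Longrightarrow> \<bar>r (i, m) - of_rat (l ! i)\<bar> < \<delta>"
    using realizing[of k l] l(1) by (auto simp: realizing_def \<delta>_def)
  have "\<bar>r (i, m) - a i\<bar> < \<epsilon>" if "i < n" for i
    using m[OF that] l(2)[OF that] k[folded \<delta>_def] by linarith
  then show "\<exists>m. \<forall>i<n. \<bar>r (i, m) - a i\<bar> < \<epsilon>" by blast
qed

definition universality_conditions :: "(nat \<times> nat \<Rightarrow> real) set set" where
  "universality_conditions =
     {nonvanishing_at i j |i j. i \<noteq> j} \<union>
     {realizing (inverse (real (Suc k))) (length l) (\<lambda>i. of_rat (l ! i)) |k l. True}"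

lemma countable_universality_conditions: "countable universality_conditions"
proof -
  have "universality_conditions \<subseteq>
      range (\<lambda>(i, j). nonvanishing_at i j) \<union>
      range (\<lambda>(k, l). realizing (inverse (real (Suc k))) (length l) (\<lambda>i. of_rat (l ! i)))"
    by (fastforce simp: universality_conditions_def)
  then show ?thesis
    by (rule countable_subset) (intro countable_Un countable_image countableI_type)
qed

lemma universal_matrices_eq_Inter: "universal_matrices = \<Inter> universality_conditions"
proof (intro equalityI subsetI)
  fix r assume r: "r \<in> universal_matrices"
  then have "r \<in> nonvanishing_at i j" if "i \<noteq> j" for i j
    using that by (auto simp: nonvanishing_at_def universal_matrix_iff true_matrix_def)
  moreover have "r \<in> realizing (inverse (real (Suc k))) n c" for k n c
    by (intro universal_imp_realizing[OF r]) simp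
  ultimately show "r \<in> \<Inter> universality_conditions"
    unfolding universality_conditions_def by blast
next
  fix r assume r: "r \<in> \<Inter> universality_conditions"
  then have nonvanishing: "r \<in> nonvanishing_at i j" if "i \<noteq> j" for i j
    using that unfolding universality_conditions_def by blast
  have realizing: "r \<in> realizing (inverse (real (Suc k))) (length l) (\<lambda>i. of_rat (l ! i))" for k l
    using r unfolding universality_conditions_def by blast
  show "r \<in> universal_matrices"
  proof (rule universal_if_realizing_rationals[OF _ _ realizing])
    show "r \<in> infinite_distance_matrices"
      using realizing by (simp add: realizing_def)
    show "true_matrix r"
      using nonvanishing by (auto simp: true_matrix_def nonvanishing_at_def)
  qed
qed

lemma universality_conditions_open_dense:
  assumes "T \<in> universality_conditions"
  shows "openin weak_topology T \<and> weak_topology closure_of T = topspace weak_topology"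
proof -
  consider i j where "i \<noteq> j" "T = nonvanishing_at i j"
    | k n c where "T = realizing (inverse (real (Suc k))) n c"
    using assms unfolding universality_conditions_def by blast
  then show ?thesis
  proof cases
    case 1
    then show ?thesis
      using nonvanishing_at_open nonvanishing_at_dense by blast
  next
    case 2
    have "inverse (real (Suc k)) > 0" by simp
    then show ?thesis
      unfolding 2 using realizing_open realizing_dense by blast
  qed
qed

theorem theorem1:
  shows "universal_matrices \<noteq> {} \<and>
         gdelta_in weak_topology universal_matrices \<and>
         weak_topology closure_of universal_matrices = infinite_distance_matrices"
proof -
  have dense: "weak_topology closure_of universal_matrices = infinite_distance_matrices"
    using Baire_category[OF disjI1[OF completely_metrizable_weak_topology]
        countable_universality_conditions universality_conditions_open_dense]
    by (simp add: universal_matrices_eq_Inter)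
  have "universality_conditions \<noteq> {}"
    by (auto simp: universality_conditions_def)
  then have "gdelta_in weak_topology universal_matrices"
    unfolding universal_matrices_eq_Inter
    by (intro gdelta_in_Inter countable_universality_conditions open_imp_gdelta_in)
       (auto dest: universality_conditions_open_dense)
  moreover have "(\<lambda>_. 0) \<in> infinite_distance_matrices"
    by (simp add: infinite_distance_matrices_def)
  then have "universal_matrices \<noteq> {}"
    using dense by auto
  ultimately show ?thesis
    using dense by blast
qed

end
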